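(* Let $B_{\mathcal M}^+$ be the filter of non-meager downward-closed subsets of $[\omega]^\omega$. Then $\mathbf{add}(B_{\mathcal M}^+) = \mathbf{cov}(B_{\mathcal M}^+) = \mathfrak g$ and $\mathbf{unif}(B_{\mathcal M}^+) = 2^{\aleph_0}$.
   Context: $2^\omega$ carries the product topology (two-point discrete factors); meager means first category in this topology. Subsets of $\omega$ are identified with their characteristic functions, and $[\omega]^\omega \subseteq 2^\omega$ is the set of infinite subsets of $\omega$. For $x,y \subseteq \omega$, write $x \le y$ if $x - y$ is finite. A set $A \subseteq [\omega]^\omega$ is downward-closed if whenever $x \in A$, $y \in [\omega]^\omega$ and $y \le x$, then $y \in A$. $\mathcal M([\omega]^\omega)$ is the lattice (under inclusion) of downward-closed subsets of $[\omega]^\omega$, and $B_{\mathcal M}^+$ is the family of its non-meager members. A set $G \subseteq [\omega]^\omega$ is groupwise dense if it is downward-closed and, for every partition of $\omega$ into finite (nonempty) intervals, the union of some infinitely many of the intervals belongs to $G$. The cardinal $\mathfrak g$ is the smallest number of groupwise dense families whose intersection is empty. The cardinal characteristics of a filter are by definition the corresponding characteristics of the ideal of complements of its members. For $B_{\mathcal M}^+$ this means: $\mathbf{add}(B_{\mathcal M}^+)$ is the minimum number of sets in $B_{\mathcal M}^+$ whose intersection is not in $B_{\mathcal M}^+$; $\mathbf{cov}(B_{\mathcal M}^+)$ is the minimum number of sets in $B_{\mathcal M}^+$ whose intersection is empty; $\mathbf{unif}(B_{\mathcal M}^+)$ is the minimum cardinality of a subset of $[\omega]^\omega$ that meets every set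 in $B_{\mathcal M}^+$. *)

theory Defs
  imports "HOL-Analysis.Analysis" "HOL-Library.Disjoint_Sets"
begin

unbundle cardinal_syntax

definition nowhere_dense_in :: "'a topology \<Rightarrow> 'a set \<Rightarrow> bool" where
  "nowhere_dense_in X S \<longleftrightarrow> S \<subseteq> topspace X \<and> X interior_of (X closure_of S) = {}"

definition meager_in :: "'a topology \<Rightarrow> 'a set \<Rightarrow> bool" where
  "meager_in X S \<longleftrightarrow> (\<exists>\<N>. countable \<N> \<and> (\<forall>N\<in>\<N>. nowhere_dense_in X N) \<and> S = \<Union>\<N>)"

definition cantor_space :: "(nat \<Rightarrow> bool) topology" where
  "cantor_space = product_topology (\<lambda>_. discrete_topology UNIV) UNIV"

definition char_fun :: "nat set \<Rightarrow> nat \<Rightarrow> bool" where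
  "char_fun x = (\<lambda>n. n \<in> x)"

definition infinite_sets :: "nat set set" where
  "infinite_sets = {x. infinite x}"

definition almost_subset :: "nat set \<Rightarrow> nat set \<Rightarrow> bool" where
  "almost_subset x y \<longleftrightarrow> finite (x - y)"

definition downward_closed :: "nat set set \<Rightarrow> bool" where
  "downward_closed A \<longleftrightarrow> A \<subseteq> infinite_sets \<and>
     (\<forall>x\<in>A. \<forall>y\<in>infinite_sets. almost_subset y x \<longrightarrow> y \<in> A)"

definition nonmeager_filter :: "nat set set set" where
  "nonmeager_filter = {A. downward_closed A \<and> \<not> meager_in cantor_space (char_fun ` A)}"

definition interval_partition :: "nat set set \<Rightarrow> bool" where
  "interval_partition P \<longleftrightarrow> partition_on UNIV P \<and> (\<forall>I\<in>P. \<exists>m n. I = {m..n})"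

definition groupwise_dense :: "nat set set \<Rightarrow> bool" where
  "groupwise_dense G \<longleftrightarrow> downward_closed G \<and>
     (\<forall>P. interval_partition P \<longrightarrow> (\<exists>Q\<subseteq>P. infinite Q \<and> \<Union>Q \<in> G))"

text \<open>
  Cardinals are represented by cardinal orders, up to \<open>=o\<close>. The predicate below states that
  \<open>\<kappa>\<close> is the least cardinality of a set satisfying \<open>P\<close>; it determines \<open>\<kappa>\<close> up to \<open>=o\<close>, and it
  requires the minimum to be attained, so that it holds of no \<open>\<kappa>\<close> if no set satisfies \<open>P\<close>.
\<close>

definition is_min_card :: "('a set \<Rightarrow> bool) \<Rightarrow> 'b rel \<Rightarrow> bool" where
  "is_min_card P \<kappa> \<longleftrightarrow> Card_order \<kappa> \<and> (\<exists>F. P F \<and> |F| =o \<kappa>) \<and> (\<forall>F. P F \<longrightarrow> \<kappa> \<le>o |F| )"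

text \<open>
  Intersections of families are taken inside \<^const>\<open>infinite_sets\<close>. Without this the
  empty family would have intersection \<^const>\<open>UNIV\<close>, which is not a member of
  \<^const>\<open>nonmeager_filter\<close>, and the additivity would be 0 for that reason alone.
\<close>

definition family_inter :: "nat set set set \<Rightarrow> nat set set" where
  "family_inter F = infinite_sets \<inter> \<Inter>F"

definition is_add :: "nat set set set \<Rightarrow> 'b rel \<Rightarrow> bool" where
  "is_add B \<kappa> \<longleftrightarrow> is_min_card (\<lambda>F. F \<subseteq> B \<and> family_inter F \<notin> B) \<kappa>"

definition is_cov :: "nat set set set \<Rightarrow> 'b rel \<Rightarrow> bool" where
  "is_cov B \<kappa> \<longleftrightarrow> is_min_card (\<lambda>F. F \<subseteq> B \<and> family_inter F = {}) \<kappa>"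

definition is_unif :: "nat set set set \<Rightarrow> 'b rel \<Rightarrow> bool" where
  "is_unif B \<kappa> \<longleftrightarrow> is_min_card (\<lambda>Y. Y \<subseteq> infinite_sets \<and> (\<forall>A\<in>B. Y \<inter> A \<noteq> {})) \<kappa>"

definition is_groupwise_density_number :: "'b rel \<Rightarrow> bool" where
  "is_groupwise_density_number \<kappa> \<longleftrightarrow>
     is_min_card (\<lambda>F. (\<forall>G\<in>F. groupwise_dense G) \<and> family_inter F = {}) \<kappa>"

end

theory Submission
  imports Defs "HOL-Library.Nat_Bijection"
begin

text \<open>
  By the Talagrand--Jalali-Naini argument, a downward-closed family is non-meager iff it is groupwise
  dense: a meager set misses some pattern along an interval partition almost everywhere, and the
  sets containing only finitely many intervals of a given partition form a meager set. If the
  intersection of a collection of groupwise dense families fails to be groupwise dense, as witnessed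
  by a partition \<open>(I\<^sub>n)\<close>, then the families of those \<open>X\<close> for which \<open>\<Union>n\<in>X. I\<^sub>n\<close> lies in a given
  member of the collection are groupwise dense with empty intersection; hence additivity and
  covering agree. For the uniformity, fewer than continuum many sets \<open>y\<close> cannot catch, by
  \<open>y \<le> x\<close>, all members \<open>x\<close> of an almost disjoint family of continuum many unions of intervals, so the sets
  that almost contain none of the given \<open>y\<close> form a groupwise dense family.
\<close>

section \<open>Interval partitions\<close>

text \<open>An interval partition is coded by the increasing sequence of its left endpoints,
  starting at 0, and \<open>X\<close> selects intervals by index. Subfamilies thus become sets of
  naturals, and coarsenings become compositions.\<close>

definition blocks :: "(nat \<Rightarrow> nat) \<Rightarrow> nat set \<Rightarrow> nat set" where
  "blocks a X = (\<Union>n\<in>X. {a n..<a (Suc n)})"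

lemma block_eqI:
  fixes a :: "nat \<Rightarrow> nat"
  assumes "mono a" "i \<in> {a m..<a (Suc m)}" "i \<in> {a n..<a (Suc n)}"
  shows "m = n"
proof -
  have "\<not> m < n" "\<not> n < m"
    using assms monoD[OF assms(1), of "Suc m" n] monoD[OF assms(1), of "Suc n" m]
    by (auto simp: Suc_le_eq)
  then show ?thesis by simp
qed

lemma in_blocks_iff:
  assumes "mono a" "i \<in> {a n..<a (Suc n)}"
  shows "i \<in> blocks a X \<longleftrightarrow> n \<in> X"
  using assms block_eqI[OF assms(1)] unfolding blocks_def by blast

lemma blocks_atLeastLessThan:
  assumes "mono a" "p \<le> q"
  shows "blocks a {p..<q} = {a p..<a q}"
  using assms(2)
proof (induction q rule: dec_induct)
  case base
  then show ?case by (simp add: blocks_def)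
next
  case (step q)
  have "blocks a {p..<Suc q} = blocks a {p..<q} \<union> {a q..<a (Suc q)}"
    using step(1) by (auto simp: blocks_def atLeastLessThanSuc)
  then show ?case
    using step monoD[OF assms(1), of p q] monoD[OF assms(1), of q "Suc q"] by auto
qed

text \<open>Merging blocks telescopes: the indices in one block of \<open>b\<close> make up exactly
  one block of \<open>a \<circ> b\<close>.\<close>

lemma blocks_blocks:
  assumes "mono a" "mono b"
  shows "blocks a (blocks b X) = blocks (a \<circ> b) X"
proof -
  have "blocks a (blocks b X) = (\<Union>n\<in>X. blocks a {b n..<b (Suc n)})"
    by (auto simp: blocks_def)
  also have "\<dots> = blocks (a \<circ> b) X"
    using blocks_atLeastLessThan[OF assms(1) monoD[OF assms(2)]] by (simp add: blocks_def)
  finally show ?thesis .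
qed

lemma ex_block:
  fixes a :: "nat \<Rightarrow> nat"
  assumes "strict_mono a" "a 0 = 0"
  shows "\<exists>n. i \<in> {a n..<a (Suc n)}"
proof -
  have "i \<in> {a 0..<a (Suc i)}"
    using strict_mono_imp_increasing[OF assms(1), of "Suc i"] assms(2) by auto
  then have "i \<in> blocks a {0..<Suc i}"
    using blocks_atLeastLessThan[of a 0 "Suc i"] strict_mono_mono[OF assms(1)] by simp
  then show ?thesis by (auto simp: blocks_def)
qed

lemma infinite_blocks:
  assumes "strict_mono a" "infinite X"
  shows "infinite (blocks a X)"
proof -
  have "a n \<in> {a n..<a (Suc n)}" for n
    using assms(1) by (simp add: strict_mono_Suc_iff)
  then have "a ` X \<subseteq> blocks a X"
    unfolding blocks_def by blast
  moreover have "inj_on a X"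
    using assms(1) by (rule strict_mono_imp_inj_on)
  then have "infinite (a ` X)"
    using assms(2) by (simp add: finite_image_iff)
  ultimately show ?thesis by (meson finite_subset)
qed

lemma finite_blocks: "finite X \<Longrightarrow> finite (blocks a X)"
  by (simp add: blocks_def)

lemma blocks_Diff_subset: "blocks a X - blocks a Y \<subseteq> blocks a (X - Y)"
  by (auto simp: blocks_def)

lemma blocks_Int:
  assumes "mono a"
  shows "blocks a X \<inter> blocks a Y = blocks a (X \<inter> Y)"
  using in_blocks_iff[OF assms] unfolding blocks_def by blast

lemma interval_partition_range:
  assumes "strict_mono a" "a 0 = 0"
  shows "interval_partition (range (\<lambda>n. {a n..<a (Suc n)}))"
proof -
  have nonempty: "a n < a (Suc n)" for n
    using assms(1) by (simp add: strict_mono_Suc_iff)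
  have "partition_on UNIV (range (\<lambda>n. {a n..<a (Suc n)}))"
  proof (rule partition_onI)
    show "{} \<notin> range (\<lambda>n. {a n..<a (Suc n)})"
      using nonempty by (auto simp: not_le)
    show "\<Union> (range (\<lambda>n. {a n..<a (Suc n)})) = UNIV"
      using ex_block[OF assms] by blast
    show "disjnt p q" if "p \<in> range (\<lambda>n. {a n..<a (Suc n)})"
      "q \<in> range (\<lambda>n. {a n..<a (Suc n)})" "p \<noteq> q" for p q
      using that block_eqI[OF strict_mono_mono[OF assms(1)]] unfolding disjnt_iff by blast
  qed
  moreover have "{a n..<a (Suc n)} = {a n..a (Suc n) - 1}" for n
    using nonempty[of n] by auto
  ultimately show ?thesis
    unfolding interval_partition_def by blast
qed

text \<open>The endpoints are generated from 0: if a cell ends in \<open>e\<close>, the cell of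
  \<open>Suc e\<close> cannot contain \<open>e\<close> without coinciding with the first, so it
  starts at \<open>Suc e\<close>.\<close>

lemma interval_partitionE:
  assumes "interval_partition P"
  obtains a where "strict_mono a" "a 0 = 0" "P = range (\<lambda>n. {a n..<a (Suc n)})"
proof -
  have part: "partition_on UNIV P" and ivl: "\<And>I. I \<in> P \<Longrightarrow> \<exists>m n. I = {m..n}"
    using assms by (auto simp: interval_partition_def)
  have cover: "\<exists>m n. {m..n} \<in> P \<and> m \<le> i \<and> i \<le> n" for i
    using partition_onD1[OF part] ivl by (metis UNIV_I UnionE atLeastAtMost_iff)
  have same: "I = J" if "I \<in> P" "J \<in> P" "i \<in> I" "i \<in> J" for I J i
    using partition_onD2[OF part] that by (auto simp: disjoint_def)
  \<comment> \<open>\<open>?S\<close> singles out the left ends of cells; it is the invariant of the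
    iteration of \<open>f\<close> below.\<close>
  let ?S = "\<lambda>x. \<exists>e\<ge>x. {x..e} \<in> P"
  have "?S 0" using cover[of 0] by auto
  have step: "\<exists>y. ?S y \<and> x < y \<and> {x..<y} \<in> P" if Sx: "?S x" for x
  proof -
    obtain e where e: "e \<ge> x" "{x..e} \<in> P" using Sx by blast
    obtain m n where mn: "{m..n} \<in> P" "m \<le> Suc e" "Suc e \<le> n" using cover[of "Suc e"] by auto
    have "m = Suc e"
    proof (rule ccontr)
      assume "m \<noteq> Suc e"
      then have "e \<in> {m..n}" "e \<in> {x..e}" using mn e by auto
      then have "{m..n} = {x..e}" using same[OF mn(1) e(2)] by blast
      moreover have "Suc e \<in> {m..n}" using mn by simp
      ultimately show False by simp
    qed
    then have "?S (Suc e) \<and> x < Suc e \<and> {x..<Suc e} \<in> P"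
      using mn e by (auto simp: atLeastLessThanSuc_atLeastAtMost)
    then show ?thesis by (rule exI)
  qed
  then obtain f where f: "\<And>x. ?S x \<Longrightarrow> ?S (f x) \<and> x < f x \<and> {x..<f x} \<in> P" by metis
  define a where "a n = (f ^^ n) 0" for n
  have S: "?S (a n)" for n using \<open>?S 0\<close> f by (induction n) (auto simp: a_def)
  have a: "a 0 = 0" "a n < a (Suc n) \<and> {a n..<a (Suc n)} \<in> P" for n
    using f[OF S[of n]] by (simp_all add: a_def)
  have sm: "strict_mono a" using a by (simp add: strict_mono_Suc_iff)
  \<comment> \<open>A cell shares a point with some generated block, which is itself a cell, so the
    two coincide.\<close>
  have "P \<subseteq> range (\<lambda>n. {a n..<a (Suc n)})"
  proof
    fix I assume "I \<in> P"
    then obtain i where "i \<in> I" using partition_onD3[OF part] by (metis ex_in_conv)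
    moreover obtain n where "i \<in> {a n..<a (Suc n)}" using ex_block[OF sm a(1)] by blast
    ultimately show "I \<in> range (\<lambda>n. {a n..<a (Suc n)})"
      using same[OF \<open>I \<in> P\<close>] a(2) by blast
  qed
  then have "P = range (\<lambda>n. {a n..<a (Suc n)})" using a(2) by blast
  then show ?thesis by (rule that[OF sm a(1)])
qed

text \<open>Enumerating the intervals is injective, so infinite subfamilies correspond to infinite
  index sets.\<close>

lemma groupwise_dense_iff:
  "groupwise_dense G \<longleftrightarrow> downward_closed G \<and>
     (\<forall>a. strict_mono a \<longrightarrow> a 0 = 0 \<longrightarrow> (\<exists>X. infinite X \<and> blocks a X \<in> G))"
proof -
  have "(\<exists>Q\<subseteq>range (\<lambda>n. {a n..<a (Suc n)}). infinite Q \<and> \<Union>Q \<in> G)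
      \<longleftrightarrow> (\<exists>X. infinite X \<and> blocks a X \<in> G)" if "strict_mono a" for a
  proof -
    have "inj (\<lambda>n. {a n..<a (Suc n)})"
    proof (rule injI)
      fix m n assume eq: "{a m..<a (Suc m)} = {a n..<a (Suc n)}"
      have "a m \<in> {a m..<a (Suc m)}" using that by (simp add: strict_mono_Suc_iff)
      with eq show "m = n" using block_eqI[OF strict_mono_mono[OF that]] by metis
    qed
    then have "infinite ((\<lambda>n. {a n..<a (Suc n)}) ` X) \<longleftrightarrow> infinite X" for X
      by (meson finite_image_iff inj_on_subset subset_UNIV)
    moreover have "(\<exists>Q\<subseteq>range f. R Q) \<longleftrightarrow> (\<exists>X. R (f ` X))" for f :: "nat \<Rightarrow> nat set" and R
      unfolding subset_image_iff by auto
    ultimately show ?thesis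
      by (simp add: blocks_def)
  qed
  moreover have "(\<forall>P. interval_partition P \<longrightarrow> R P) \<longleftrightarrow>
      (\<forall>a. strict_mono a \<longrightarrow> a 0 = 0 \<longrightarrow> R (range (\<lambda>n. {a n..<a (Suc n)})))" for R
    using interval_partition_range by (auto elim!: interval_partitionE)
  ultimately show ?thesis
    unfolding groupwise_dense_def by simp
qed

lemma downward_closedD:
  assumes "downward_closed A" "x \<in> A" "infinite y" "finite (y - x)"
  shows "y \<in> A"
  using assms by (auto simp: downward_closed_def almost_subset_def infinite_sets_def)

section \<open>Category in the Cantor space\<close>

text \<open>Basic clopen set of a word of length \<open>n\<close>. The word is a total function read
  only below \<open>n\<close>, so that words can be continued by case distinction.\<close>

definition cylinder :: "(nat \<Rightarrow> bool) \<Rightarrow> nat \<Rightarrow> (nat \<Rightarrow> bool) set" where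
  "cylinder s n = {x. \<forall>i<n. x i = s i}"

lemma self_in_cylinder: "s \<in> cylinder s n"
  by (simp add: cylinder_def)

lemma topspace_cantor_space [simp]: "topspace cantor_space = UNIV"
  by (simp add: cantor_space_def)

lemma openin_cylinder: "openin cantor_space (cylinder s n)"
proof -
  have "cylinder s n = PiE UNIV (\<lambda>i. if i < n then {s i} else UNIV)"
    by (auto simp: cylinder_def PiE_iff split: if_splits)
  moreover have "finite {i. (if i < n then {s i} else UNIV) \<noteq> UNIV}"
    by (rule finite_subset[of _ "{..<n}"]) auto
  ultimately show ?thesis
    unfolding cantor_space_def by (simp add: product_topology_basis)
qed

lemma openin_contains_cylinder:
  assumes "openin cantor_space U" "s \<in> U"
  shows "\<exists>n. cylinder s n \<subseteq> U"
proof -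
  obtain V where V: "s \<in> PiE UNIV V" "finite {i. V i \<noteq> UNIV}" "PiE UNIV V \<subseteq> U"
    using product_topology_open_contains_basis[OF assms[unfolded cantor_space_def]] by auto
  obtain n where n: "{i. V i \<noteq> UNIV} \<subseteq> {..<n}"
    using V(2) finite_nat_iff_bounded by blast
  have "cylinder s n \<subseteq> PiE UNIV V"
  proof
    fix x assume x: "x \<in> cylinder s n"
    have "x i \<in> V i" for i
    proof (cases "i < n")
      case True
      then show ?thesis using x V(1) by (auto simp: cylinder_def PiE_iff)
    next
      case False
      then show ?thesis using n by blast
    qed
    then show "x \<in> PiE UNIV V" by auto
  qed
  then show ?thesis using V(3) by blast
qed

text \<open>Lengthening a word shrinks its cylinder, which secures \<open>n \<le> m\<close>; then
  \<open>u\<close> below \<open>m\<close> continues \<open>s\<close> below \<open>n\<close>, the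
  form needed for building patterns.\<close>

lemma nowhere_dense_in_cantor_space_iff:
  "nowhere_dense_in cantor_space N \<longleftrightarrow>
     (\<forall>s n. \<exists>u m. u \<in> cylinder s n \<and> n \<le> m \<and> cylinder u m \<inter> N = {})"
  (is "?L \<longleftrightarrow> ?R")
proof
  assume ?L
  then have emp: "cantor_space interior_of (cantor_space closure_of N) = {}"
    by (simp add: nowhere_dense_in_def)
  show ?R
  proof (intro allI)
    fix s n
    have "\<not> cylinder s n \<subseteq> cantor_space closure_of N"
      using emp interior_of_maximal[OF _ openin_cylinder] self_in_cylinder by blast
    then obtain u where u: "u \<in> cylinder s n" "u \<notin> cantor_space closure_of N" by blast
    then obtain T where T: "openin cantor_space T" "u \<in> T" "T \<inter> N = {}"
      by (auto simp: in_closure_of)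
    then obtain m where "cylinder u m \<subseteq> T" using openin_contains_cylinder by blast
    moreover have "cylinder u (max n m) \<subseteq> cylinder u m"
      by (simp add: cylinder_def subset_iff)
    ultimately have "cylinder u (max n m) \<inter> N = {}"
      using T(3) by blast
    then show "\<exists>u m. u \<in> cylinder s n \<and> n \<le> m \<and> cylinder u m \<inter> N = {}"
      using u(1) by (meson max.cobounded1)
  qed
next
  assume R: ?R
  have False if s: "s \<in> cantor_space interior_of (cantor_space closure_of N)" for s
  proof -
    obtain n where "cylinder s n \<subseteq> cantor_space interior_of (cantor_space closure_of N)"
      using openin_contains_cylinder[OF openin_interior_of s] by (elim exE)
    then have n: "cylinder s n \<subseteq> cantor_space closure_of N"
      using interior_of_subset by (rule subset_trans)
    obtain u m where um: "u \<in> cylinder s n" "cylinder u m \<inter> N = {}" using R by meson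
    then have "u \<in> cantor_space closure_of N" using n by (simp add: subset_iff)
    then have "\<exists>y. y \<in> N \<and> y \<in> cylinder u m"
      using openin_cylinder self_in_cylinder unfolding in_closure_of by meson
    then show False
      using um(2) by auto
  qed
  then show ?L by (auto simp: nowhere_dense_in_def)
qed

text \<open>Intersecting each \<open>N k\<close> with \<open>S\<close> turns the cover into the
  exact union that the definition demands.\<close>

lemma meager_in_cantor_spaceI:
  assumes "\<And>k::nat. nowhere_dense_in cantor_space (N k)" "S \<subseteq> (\<Union>k. N k)"
  shows "meager_in cantor_space S"
proof -
  have "nowhere_dense_in cantor_space (N k \<inter> S)" for k
    using assms(1)[of k] unfolding nowhere_dense_in_cantor_space_iff by blast
  moreover have "S = \<Union> (range (\<lambda>k. N k \<inter> S))" using assms(2) by blast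
  ultimately show ?thesis
    unfolding meager_in_def by (intro exI[of _ "range (\<lambda>k. N k \<inter> S)"]) auto
qed

lemma meager_in_cantor_spaceE:
  assumes "meager_in cantor_space S"
  obtains N :: "nat \<Rightarrow> (nat \<Rightarrow> bool) set"
  where "\<And>k. nowhere_dense_in cantor_space (N k)" "S \<subseteq> (\<Union>k. N k)"
proof -
  obtain \<N> where \<N>: "countable \<N>" "\<forall>N\<in>\<N>. nowhere_dense_in cantor_space N" "S = \<Union>\<N>"
    using assms by (auto simp: meager_in_def)
  \<comment> \<open>Adding the empty set makes the family nonempty, so that
    \<open>from_nat_into\<close> enumerates it.\<close>
  have "nowhere_dense_in cantor_space {}"
    by (auto simp: nowhere_dense_in_def)
  then have "\<forall>N\<in>range (from_nat_into (insert {} \<N>)). nowhere_dense_in cantor_space N"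
    using \<N> by (simp add: range_from_nat_into)
  moreover have "S \<subseteq> \<Union> (range (from_nat_into (insert {} \<N>)))"
    using \<N> by (simp add: range_from_nat_into)
  ultimately show ?thesis by (intro that[of "from_nat_into (insert {} \<N>)"]) auto
qed

section \<open>Patterns that members of a meager set match only finitely often\<close>

text \<open>A single word \<open>t\<close> on \<open>{n..<m}\<close> serves all pairs in
  \<open>F\<close>: they are treated one by one, each time prolonging the word found so far, which
  preserves what it already achieves.\<close>

lemma nowhere_dense_uniform_extension:
  assumes nd: "\<And>j. nowhere_dense_in cantor_space (N j)" and "finite F"
  shows "\<exists>m>n. \<exists>t. \<forall>s j x. (s, j) \<in> F \<longrightarrow> x \<in> cylinder s n \<longrightarrow> (\<forall>i\<in>{n..<m}. x i = t i) \<longrightarrow> x \<notin> N j"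
  using assms(2)
proof (induction F)
  case empty
  then show ?case by (intro exI[of _ "Suc n"]) simp
next
  case (insert p F)
  obtain s j where p: "p = (s, j)" by (cases p)
  obtain m t where mt: "m > n"
    "\<And>s j x. (s, j) \<in> F \<Longrightarrow> x \<in> cylinder s n \<Longrightarrow> \<forall>i\<in>{n..<m}. x i = t i \<Longrightarrow> x \<notin> N j"
    using insert.IH by metis
  \<comment> \<open>The new stem \<open>s\<close> followed by the common word \<open>t\<close>; any
    \<open>u\<close> that continues it from \<open>m\<close> on still meets the old demands.\<close>
  define v where "v i = (if i < n then s i else t i)" for i
  obtain u m' where u: "u \<in> cylinder v m" "m \<le> m'" "cylinder u m' \<inter> N j = {}"
    using nd nowhere_dense_in_cantor_space_iff by meson
  have new: "x \<notin> N j" if "x \<in> cylinder s n" "\<forall>i\<in>{n..<m'}. x i = u i" for x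
  proof -
    have "x i = u i" if "i < m'" for i
      using \<open>x \<in> cylinder s n\<close> \<open>\<forall>i\<in>{n..<m'}. x i = u i\<close> that u(1) mt(1)
      by (cases "i < n") (auto simp: cylinder_def v_def)
    then show ?thesis using u(3) by (auto simp: cylinder_def)
  qed
  have old: "x \<notin> N j'" if "(s', j') \<in> F" "x \<in> cylinder s' n" "\<forall>i\<in>{n..<m'}. x i = u i" for s' j' x
  proof -
    have "\<forall>i\<in>{n..<m}. x i = t i"
      using that(3) u(1,2) by (auto simp: cylinder_def v_def)
    then show ?thesis using mt(2) that by blast
  qed
  show ?case
    using mt(1) u(2) new old p by (intro exI[of _ m'] conjI exI[of _ u]) auto
qed

lemma finite_supported_below: "finite {s :: nat \<Rightarrow> bool. \<forall>i\<ge>n. \<not> s i}"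
proof -
  have "{s :: nat \<Rightarrow> bool. \<forall>i\<ge>n. \<not> s i} \<subseteq> (\<lambda>A i. i \<in> A) ` Pow {..<n}"
  proof
    fix s :: "nat \<Rightarrow> bool" assume "s \<in> {s. \<forall>i\<ge>n. \<not> s i}"
    then have "{i. s i} \<in> Pow {..<n}" by (auto simp: not_le[symmetric])
    then show "s \<in> (\<lambda>A i. i \<in> A) ` Pow {..<n}" by (intro image_eqI[of _ _ "{i. s i}"]) auto
  qed
  then show ?thesis by (rule finite_subset) simp
qed

text \<open>Block \<open>k\<close> of the pattern is chosen so that matching it, whatever the values
  before, keeps a point out of \<open>N 0, ..., N k\<close>. A point of \<open>N j\<close> can then
  match only blocks with index below \<open>j\<close>.\<close>

lemma meager_avoids_pattern:
  assumes "meager_in cantor_space S"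
  obtains c r where "strict_mono c" "c 0 = 0"
    "\<And>x. x \<in> S \<Longrightarrow> finite {n. \<forall>i\<in>{c n..<c (Suc n)}. x i = r i}"
proof -
  obtain N :: "nat \<Rightarrow> (nat \<Rightarrow> bool) set"
    where N: "\<And>k. nowhere_dense_in cantor_space (N k)" "S \<subseteq> (\<Union>k. N k)"
    using meager_in_cantor_spaceE[OF assms] by blast
  have "\<exists>m>n. \<exists>t. \<forall>x. (\<forall>i\<in>{n..<m}. x i = t i) \<longrightarrow> (\<forall>j\<le>k. x \<notin> N j)" for n k
  proof -
    \<comment> \<open>One demand for each word of length \<open>n\<close>, padded with
      \<open>False\<close>, and each index up to \<open>k\<close>; every \<open>x\<close> lies in
      the cylinder of its own truncation.\<close>
    let ?F = "{s :: nat \<Rightarrow> bool. \<forall>i\<ge>n. \<not> s i} \<times> {..k}"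
    have "finite ?F" using finite_supported_below by blast
    obtain m t where mt: "m > n"
      "\<forall>s j x. (s, j) \<in> ?F \<longrightarrow> x \<in> cylinder s n \<longrightarrow> (\<forall>i\<in>{n..<m}. x i = t i) \<longrightarrow> x \<notin> N j"
      using nowhere_dense_uniform_extension[where N = N and n = n, OF N(1) \<open>finite ?F\<close>]
      by (elim exE conjE)
    have "x \<notin> N j" if "\<forall>i\<in>{n..<m}. x i = t i" "j \<le> k" for x j
    proof (rule mt(2)[rule_format])
      show "((\<lambda>i. i < n \<and> x i), j) \<in> ?F" using that by auto
      show "x \<in> cylinder (\<lambda>i. i < n \<and> x i) n" by (simp add: cylinder_def)
    qed (use that in auto)
    then show ?thesis using mt(1) by blast
  qed
  then have "\<forall>n k. \<exists>p. fst p > n \<and> (\<forall>x. (\<forall>i\<in>{n..<fst p}. x i = snd p i) \<longrightarrow> (\<forall>j\<le>k. x \<notin> N j))"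
    by simp
  then obtain p where
    "\<forall>n k. fst (p n k) > n \<and>
      (\<forall>x. (\<forall>i\<in>{n..<fst (p n k)}. x i = snd (p n k) i) \<longrightarrow> (\<forall>j\<le>k. x \<notin> N j))"
    unfolding choice_iff by (elim exE)
  moreover define f t where "f n k = fst (p n k)" and "t n k = snd (p n k)" for n k
  ultimately have f: "f n k > n"
    and t: "\<forall>i\<in>{n..<f n k}. x i = t n k i \<Longrightarrow> j \<le> k \<Longrightarrow> x \<notin> N j" for n k x j
    by simp_all
  define c where "c = rec_nat 0 (\<lambda>k n. f n k)"
  have c: "c 0 = 0" "c (Suc k) = f (c k) k" for k by (simp_all add: c_def)
  have sm: "strict_mono c" using f c by (simp add: strict_mono_Suc_iff)
  \<comment> \<open>The local words are glued; the blocks are disjoint, so each \<open>i\<close> is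
    governed by one \<open>k\<close> only.\<close>
  define r where "r i = (\<exists>k. i \<in> {c k..<c (Suc k)} \<and> t (c k) k i)" for i
  have r: "r i = t (c k) k i" if "i \<in> {c k..<c (Suc k)}" for i k
    using block_eqI[OF strict_mono_mono[OF sm]] that unfolding r_def by blast
  have "finite {n. \<forall>i\<in>{c n..<c (Suc n)}. x i = r i}" if "x \<in> S" for x
  proof -
    obtain j where j: "x \<in> N j" using N(2) \<open>x \<in> S\<close> by blast
    have "n < j" if "\<forall>i\<in>{c n..<c (Suc n)}. x i = r i" for n
    proof (rule ccontr)
      assume "\<not> n < j"
      moreover have "\<forall>i\<in>{c n..<f (c n) n}. x i = t (c n) n i"
        using that r by (simp add: c(2))
      ultimately show False using t[of "c n" n x j] j by simp
    qed
    then have "{n. \<forall>i\<in>{c n..<c (Suc n)}. x i = r i} \<subseteq> {..<j}" by blast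
    then show ?thesis using finite_subset by blast
  qed
  then show ?thesis by (rule that[OF sm c(1)])
qed

section \<open>Groupwise dense families are the non-meager downward-closed ones\<close>

text \<open>Some infinite union of blocks in \<open>G\<close> has an infinite subset that copies the
  avoided pattern on infinitely many blocks; by downward closure this subset is in \<open>G\<close>,
  a contradiction.\<close>

lemma groupwise_dense_not_meager:
  assumes "groupwise_dense G"
  shows "\<not> meager_in cantor_space (char_fun ` G)"
proof
  assume "meager_in cantor_space (char_fun ` G)"
  then obtain c r where sm: "strict_mono c" and c0: "c 0 = 0"
    and fin: "\<And>x. x \<in> char_fun ` G \<Longrightarrow> finite {n. \<forall>i\<in>{c n..<c (Suc n)}. x i = r i}"
    by (rule meager_avoids_pattern) blast
  have mono: "mono c" using sm by (rule strict_mono_mono)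
  \<comment> \<open>Blocks of \<open>c\<close> are merged in pairs, since copying the pattern alone
    could give a finite set, as when \<open>r\<close> is constantly \<open>False\<close>.\<close>
  define a where "a = c \<circ> (*) 2"
  have "strict_mono a" "a 0 = 0"
    using sm c0 by (auto simp: a_def strict_mono_def)
  then obtain X where X: "infinite X" "blocks a X \<in> G"
    using assms groupwise_dense_iff by blast
  \<comment> \<open>On even blocks follow the pattern; odd blocks are kept whole, so that the result is infinite.\<close>
  define x where "x = blocks c ((*) 2 ` X) \<inter> Collect r \<union> blocks c ((\<lambda>n. Suc (2 * n)) ` X)"
  have "a n = c (2 * n)" "a (Suc n) = c (Suc (Suc (2 * n)))" for n
    by (simp_all add: a_def)
  then have "{c (2 * n)..<c (Suc (2 * n))} \<subseteq> {a n..<a (Suc n)}"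
    "{c (Suc (2 * n))..<c (Suc (Suc (2 * n)))} \<subseteq> {a n..<a (Suc n)}" for n
    using monoD[OF mono] by auto
  then have "x \<subseteq> blocks a X"
    unfolding x_def blocks_def by blast
  moreover have "infinite ((\<lambda>n. Suc (2 * n)) ` X)"
    using X(1) by (simp add: finite_image_iff inj_on_def)
  then have "infinite x"
    using infinite_blocks[OF sm] unfolding x_def by blast
  ultimately have "x \<in> G"
    using assms X(2) downward_closedD[of G "blocks a X" x]
    by (auto simp: groupwise_dense_def Diff_eq_empty_iff[THEN iffD2])
  have "char_fun x i = r i" if "n \<in> X" "i \<in> {c (2 * n)..<c (Suc (2 * n))}" for n i
  proof -
    have "2 * n \<noteq> Suc (2 * k)" for k by presburger
    then have "2 * n \<in> (*) 2 ` X" "2 * n \<notin> (\<lambda>n. Suc (2 * n)) ` X" using \<open>n \<in> X\<close> by auto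
    then show ?thesis
      using in_blocks_iff[OF mono that(2)] by (simp add: x_def char_fun_def)
  qed
  then have "(*) 2 ` X \<subseteq> {n. \<forall>i\<in>{c n..<c (Suc n)}. char_fun x i = r i}" by auto
  moreover have "infinite ((*) 2 ` X)"
    using X(1) by (simp add: finite_image_iff inj_on_def)
  ultimately show False using fin \<open>x \<in> G\<close> by (meson finite_subset imageI)
qed

text \<open>Having no full block from index \<open>k\<close> on is a nowhere dense condition: any
  word can be continued by \<open>True\<close> until it fills such a block.\<close>

lemma meager_finitely_many_blocks:
  assumes "strict_mono a"
  shows "meager_in cantor_space {x. finite {n. \<forall>i\<in>{a n..<a (Suc n)}. x i}}"
proof (rule meager_in_cantor_spaceI)
  let ?N = "\<lambda>k. {x. \<forall>n\<ge>k. \<exists>i\<in>{a n..<a (Suc n)}. \<not> x i}"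
  show "nowhere_dense_in cantor_space (?N k)" for k
    unfolding nowhere_dense_in_cantor_space_iff
  proof (intro allI)
    fix s :: "nat \<Rightarrow> bool" and n
    define u where "u i = (if i < n then s i else True)" for i
    \<comment> \<open>Index at least \<open>n\<close> places the block beyond the word
      \<open>s\<close>, as \<open>n \<le> a n\<close>; index at least \<open>k\<close> makes it
      count for \<open>?N k\<close>.\<close>
    let ?l = "max n k"
    have le: "n \<le> a ?l" "a ?l \<le> a (Suc ?l)"
      using strict_mono_imp_increasing[OF assms, of ?l] assms
      by (auto simp: strict_mono_less_eq)
    have "x \<notin> ?N k" if "x \<in> cylinder u (a (Suc ?l))" for x
    proof
      assume "x \<in> ?N k"
      then obtain i where "i \<in> {a ?l..<a (Suc ?l)}" "\<not> x i" using max.cobounded2[of k n] by blast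
      then show False using that le by (auto simp: cylinder_def u_def)
    qed
    then have "cylinder u (a (Suc ?l)) \<inter> ?N k = {}" by blast
    moreover have "u \<in> cylinder s n" by (simp add: u_def cylinder_def)
    ultimately show "\<exists>u m. u \<in> cylinder s n \<and> n \<le> m \<and> cylinder u m \<inter> ?N k = {}"
      using order_trans[OF le] by (intro exI[of _ u] exI[of _ "a (Suc ?l)"]) simp
  qed
  show "{x. finite {n. \<forall>i\<in>{a n..<a (Suc n)}. x i}} \<subseteq> (\<Union>k. ?N k)"
  proof
    fix x assume "x \<in> {x. finite {n. \<forall>i\<in>{a n..<a (Suc n)}. x i}}"
    then obtain k where "{n. \<forall>i\<in>{a n..<a (Suc n)}. x i} \<subseteq> {..<k}"
      using finite_nat_iff_bounded by auto
    then have "x \<in> ?N k" by (force simp: subset_iff not_less[symmetric])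
    then show "x \<in> (\<Union>k. ?N k)" by blast
  qed
qed

lemma meager_in_cantor_space_subset:
  assumes "meager_in cantor_space S" "T \<subseteq> S"
  shows "meager_in cantor_space T"
  using assms by (meson meager_in_cantor_spaceE meager_in_cantor_spaceI subset_trans)

text \<open>A non-meager family is not covered by the meager set of points with finitely many full
  blocks. So some member contains infinitely many blocks, and their union belongs to the family by
  downward closure.\<close>

lemma nonmeager_filter_iff: "G \<in> nonmeager_filter \<longleftrightarrow> groupwise_dense G"
proof
  assume "G \<in> nonmeager_filter"
  then have dc: "downward_closed G" and nm: "\<not> meager_in cantor_space (char_fun ` G)"
    by (auto simp: nonmeager_filter_def)
  have "\<exists>X. infinite X \<and> blocks a X \<in> G" if sm: "strict_mono a" for a
  proof -
    have "\<not> char_fun ` G \<subseteq> {x. finite {n. \<forall>i\<in>{a n..<a (Suc n)}. x i}}"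
      using nm meager_in_cantor_space_subset[OF meager_finitely_many_blocks[OF sm]] by blast
    then obtain x where x: "x \<in> G" "infinite {n. \<forall>i\<in>{a n..<a (Suc n)}. i \<in> x}" (is "infinite ?X")
      unfolding char_fun_def by auto
    have "blocks a ?X - x = {}" by (auto simp: blocks_def)
    then have "finite (blocks a ?X - x)" by (simp only: finite.emptyI)
    then have "blocks a ?X \<in> G"
      by (rule downward_closedD[OF dc x(1) infinite_blocks[OF sm x(2)]])
    then show ?thesis using x(2) by blast
  qed
  then show "groupwise_dense G" using dc by (simp add: groupwise_dense_iff)
next
  assume "groupwise_dense G"
  then show "G \<in> nonmeager_filter"
    using groupwise_dense_not_meager by (auto simp: nonmeager_filter_def groupwise_dense_def)
qed

section \<open>Additivity and covering\<close>

text \<open>Apply density to the partition into singletons, coded by \<open>id\<close>.\<close>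

lemma groupwise_dense_nonempty: "groupwise_dense G \<Longrightarrow> G \<noteq> {}"
  using groupwise_dense_iff[of G] by (auto simp: strict_mono_def dest: spec[of _ id])

lemma downward_closed_family_inter:
  assumes "\<And>G. G \<in> F \<Longrightarrow> downward_closed G"
  shows "downward_closed (family_inter F)"
  using downward_closedD[OF assms] unfolding downward_closed_def[of "family_inter F"]
  by (auto simp: family_inter_def almost_subset_def infinite_sets_def)

text \<open>Density of the pullback at \<open>b\<close> is density of \<open>G\<close> at the
  coarser partition \<open>a \<circ> b\<close>.\<close>

lemma groupwise_dense_pullback:
  assumes "groupwise_dense G" "strict_mono a" "a 0 = 0"
  shows "groupwise_dense {X. infinite X \<and> blocks a X \<in> G}" (is "groupwise_dense ?G'")
  unfolding groupwise_dense_iff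
proof (intro conjI allI impI)
  have dc: "downward_closed G" using assms(1) by (simp add: groupwise_dense_def)
  have "blocks a Y \<in> G" if "infinite Y" "blocks a X \<in> G" "finite (Y - X)" for X Y
  proof (rule downward_closedD[OF dc that(2) infinite_blocks[OF assms(2) that(1)]])
    show "finite (blocks a Y - blocks a X)"
      using finite_subset[OF blocks_Diff_subset finite_blocks[OF that(3)]] .
  qed
  then show "downward_closed ?G'"
    unfolding downward_closed_def infinite_sets_def almost_subset_def by blast
  fix b :: "nat \<Rightarrow> nat" assume b: "strict_mono b" "b 0 = 0"
  have "strict_mono (a \<circ> b)" "(a \<circ> b) 0 = 0"
    using assms b by (auto simp: strict_mono_def)
  then obtain X where "infinite X" "blocks (a \<circ> b) X \<in> G"
    using assms(1) groupwise_dense_iff by blast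
  then show "\<exists>X. infinite X \<and> blocks b X \<in> ?G'"
    using blocks_blocks[OF strict_mono_mono[OF assms(2)] strict_mono_mono[OF b(1)]]
      infinite_blocks[OF b(1)] by auto
qed

text \<open>Downward closure survives intersection, so the failure occurs at some partition
  \<open>a\<close>. A set common to all pullbacks along \<open>a\<close> would select blocks with
  union in \<open>family_inter F\<close>.\<close>

lemma pullback_family_inter_empty:
  assumes "\<forall>G\<in>F. groupwise_dense G" "\<not> groupwise_dense (family_inter F)"
  shows "\<exists>F'. (\<forall>G\<in>F'. groupwise_dense G) \<and> family_inter F' = {} \<and> |F'| \<le>o |F|"
proof -
  have "downward_closed (family_inter F)"
    using assms(1) by (intro downward_closed_family_inter) (simp add: groupwise_dense_def)
  then obtain a where a: "strict_mono a" "a 0 = 0"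
    and none: "\<And>X. infinite X \<Longrightarrow> blocks a X \<notin> family_inter F"
    using assms(2) unfolding groupwise_dense_iff by blast
  let ?F = "(\<lambda>G. {X. infinite X \<and> blocks a X \<in> G}) ` F"
  have "\<forall>G\<in>?F. groupwise_dense G"
    using assms(1) groupwise_dense_pullback[OF _ a] by blast
  moreover have "family_inter ?F = {}"
    using none infinite_blocks[OF a(1)] by (fastforce simp: family_inter_def infinite_sets_def)
  ultimately show ?thesis using card_of_image by blast
qed

section \<open>Uniformity\<close>

text \<open>This family is disjoint from \<open>Y\<close>, because each \<open>y - y\<close> is
  finite. Once shown groupwise dense for small \<open>Y\<close>, it keeps such a \<open>Y\<close>
  from meeting every member of the filter.\<close>

definition not_above :: "nat set set \<Rightarrow> nat set set" where
  "not_above Y = {x. infinite x \<and> (\<forall>y\<in>Y. infinite (y - x))}"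

lemma downward_closed_not_above: "downward_closed (not_above Y)"
  unfolding downward_closed_def
proof (intro conjI ballI impI)
  show "not_above Y \<subseteq> infinite_sets" by (auto simp: not_above_def infinite_sets_def)
  fix x z assume *: "x \<in> not_above Y" "z \<in> infinite_sets" "almost_subset z x"
  have "infinite (y - z)" if "y \<in> Y" for y
  proof
    assume "finite (y - z)"
    then have "finite ((y - z) \<union> (z - x))" using *(3) by (simp add: almost_subset_def)
    then have "finite (y - x)" by (rule finite_subset[rotated]) blast
    then show False using * that by (simp add: not_above_def)
  qed
  then show "z \<in> not_above Y" using * by (simp add: not_above_def infinite_sets_def)
qed

section \<open>Continuum many almost disjoint sets\<close>

text \<open>The codes of the initial segments of \<open>A\<close>; the top element of the coded set marks its length.\<close>

definition branch :: "nat set \<Rightarrow> nat set" where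
  "branch A = range (\<lambda>n. set_encode (insert n (A \<inter> {..<n})))"

lemma branch_code_eq:
  assumes "set_encode (insert m (A \<inter> {..<m})) = set_encode (insert n (B \<inter> {..<n}))"
  shows "m = n" "A \<inter> {..<m} = B \<inter> {..<m}"
proof -
  have eq: "insert m (A \<inter> {..<m}) = insert n (B \<inter> {..<n})"
    using assms by (intro inj_onD[OF inj_on_set_encode]) auto
  \<comment> \<open>All other elements lie below the marker, so each of \<open>m\<close> and
    \<open>n\<close> is at most the other.\<close>
  then have "m \<in> insert n (B \<inter> {..<n})" "n \<in> insert m (A \<inter> {..<m})" by blast+
  then show mn: "m = n" by auto
  have "A \<inter> {..<m} = insert m (A \<inter> {..<m}) - {m}" by auto
  also have "\<dots> = insert m (B \<inter> {..<m}) - {m}" using eq mn by simp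
  also have "\<dots> = B \<inter> {..<m}" by auto
  finally show "A \<inter> {..<m} = B \<inter> {..<m}" .
qed

lemma infinite_branch: "infinite (branch A)"
  unfolding branch_def by (rule range_inj_infinite, rule injI, erule branch_code_eq(1))

text \<open>A common code has one length \<open>m\<close> and one segment below \<open>m\<close>. If
  \<open>A\<close> and \<open>B\<close> differ at \<open>k\<close>, this forces
  \<open>m \<le> k\<close>.\<close>

lemma finite_branch_Int:
  assumes "A \<noteq> B"
  shows "finite (branch A \<inter> branch B)"
proof -
  obtain k where k: "k \<in> A \<longleftrightarrow> k \<notin> B" using assms by (auto simp: set_eq_iff)
  have "branch A \<inter> branch B \<subseteq> (\<lambda>n. set_encode (insert n (A \<inter> {..<n}))) ` {..k}"
  proof
    fix p assume p: "p \<in> branch A \<inter> branch B"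
    then obtain m where m: "p = set_encode (insert m (A \<inter> {..<m}))"
      unfolding branch_def by (elim IntE rangeE)
    from p obtain n where n: "p = set_encode (insert n (B \<inter> {..<n}))"
      unfolding branch_def by (elim IntE rangeE)
    have "A \<inter> {..<m} = B \<inter> {..<m}"
      by (rule branch_code_eq(2)[OF trans[OF m[symmetric] n]])
    then have "k \<in> A \<inter> {..<m} \<longleftrightarrow> k \<in> B \<inter> {..<m}" by simp
    then have "k \<notin> {..<m}" using k by auto
    then have "m \<in> {..k}" by simp
    then show "p \<in> (\<lambda>n. set_encode (insert n (A \<inter> {..<n}))) ` {..k}"
      by (rule rev_image_eqI) (rule m)
  qed
  then show ?thesis by (rule finite_subset) simp
qed

text \<open>The sets \<open>?D A\<close> are almost disjoint, so one infinite \<open>y\<close> is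
  almost contained in at most one of them. If each almost contained some \<open>y\<close> in
  \<open>Y\<close>, choosing one would inject the continuum into \<open>Y\<close>.\<close>

lemma groupwise_dense_not_above:
  assumes "Y \<subseteq> infinite_sets" "|Y| <o |UNIV :: nat set set|"
  shows "groupwise_dense (not_above Y)"
  unfolding groupwise_dense_iff
proof (intro conjI allI impI downward_closed_not_above)
  fix a :: "nat \<Rightarrow> nat" assume a: "strict_mono a" "a 0 = 0"
  let ?D = "\<lambda>A. blocks a (branch A)"
  have inf: "infinite (?D A)" for A using infinite_blocks[OF a(1) infinite_branch] .
  have "\<exists>A. ?D A \<in> not_above Y"
  proof (rule ccontr)
    assume "\<not> ?thesis"
    then have "\<forall>A. \<exists>y\<in>Y. finite (y - ?D A)" using inf by (auto simp: not_above_def)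
    then obtain g where g: "\<And>A. g A \<in> Y" "\<And>A. finite (g A - ?D A)" by metis
    have "A = B" if "g A = g B" for A B
    proof (rule ccontr)
      assume "A \<noteq> B"
      then have "finite (?D A \<inter> ?D B)"
        by (simp add: blocks_Int[OF strict_mono_mono[OF a(1)]] finite_blocks finite_branch_Int)
      then have "finite ((g A - ?D A) \<union> (g B - ?D B) \<union> (?D A \<inter> ?D B))" using g by simp
      then have "finite (g A)" by (rule finite_subset[rotated]) (use that in auto)
      then show False using g(1) assms(1) by (auto simp: infinite_sets_def)
    qed
    then have "|UNIV :: nat set set| \<le>o |Y|"
      using g(1) by (intro card_of_ordLeqI[of g]) (auto simp: inj_on_def)
    then show False using assms(2) not_ordLess_ordLeq by blast
  qed
  then show "\<exists>X. infinite X \<and> blocks a X \<in> not_above Y"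
    using infinite_branch by (elim exE) (intro exI conjI)
qed

section \<open>The continuum and the existence of minimal cardinals\<close>

lemma ctwo_cexp_natLeq: "ctwo ^c natLeq =o |UNIV :: nat set set|"
proof -
  have "|UNIV :: nat set set| =o |Func (UNIV :: nat set) (UNIV :: bool set)|"
    using card_of_Pow_Func[of "UNIV :: nat set"] by simp
  then show ?thesis
    by (simp add: cexp_def ctwo_def Field_card_of Field_natLeq ordIso_symmetric)
qed

text \<open>Each infinite \<open>x\<close> is omitted by \<open>not_above {x}\<close>. This makes
  the groupwise density number exist, as \<open>is_min_card\<close> requires an attained
  minimum.\<close>

lemma ex_groupwise_dense_family_inter_empty:
  "\<exists>F. (\<forall>G\<in>F. groupwise_dense G) \<and> family_inter F = {}"
proof (intro exI conjI ballI)
  let ?F = "(\<lambda>x. not_above {x}) ` infinite_sets"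
  have "x \<notin> not_above {x}" for x by (simp add: not_above_def)
  then show "family_inter ?F = {}" unfolding family_inter_def by blast
  fix G assume "G \<in> ?F"
  then obtain x where x: "x \<in> infinite_sets" "G = not_above {x}" by blast
  have "\<not> |UNIV :: nat set set| \<le>o |{x}|"
    using card_of_ordLeq_infinite[of "UNIV :: nat set set" "{x}"] by (auto simp: Finite_Set.finite_set)
  then have "|{x}| <o |UNIV :: nat set set|"
    by (simp add: card_of_Well_order not_ordLeq_iff_ordLess)
  then show "groupwise_dense G" using groupwise_dense_not_above x by blast
qed

text \<open>Cardinals are well-ordered; the minimizer \<open>F0\<close> is returned too, since its
  cardinal will be the common value.\<close>

lemma is_min_card_exists:
  assumes "P F"
  obtains F0 where "P F0" "is_min_card P |F0|"
proof -
  obtain r where r: "r \<in> card_of ` Collect P" "\<forall>r'\<in>card_of ` Collect P. r \<le>o r'"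
    using exists_minim_Well_order[of "card_of ` Collect P"] assms card_of_Well_order by auto
  then obtain F0 where F0: "P F0" "r = |F0|" by blast
  then have "is_min_card P |F0|"
    using r(2) by (auto simp: is_min_card_def card_of_Card_order card_of_refl intro!: exI[of _ F0])
  with F0(1) show ?thesis by (rule that)
qed

theorem theorem4:
  shows "(\<exists>\<kappa> :: nat set set rel.
            is_add nonmeager_filter \<kappa> \<and>
            is_cov nonmeager_filter \<kappa> \<and>
            is_groupwise_density_number \<kappa>) \<and>
         is_unif nonmeager_filter (ctwo ^c natLeq)"
proof
  have sub: "F \<subseteq> nonmeager_filter \<longleftrightarrow> (\<forall>G\<in>F. groupwise_dense G)" for F
    using nonmeager_filter_iff by blast
  let ?P = "\<lambda>F. (\<forall>G\<in>F. groupwise_dense G) \<and> family_inter F = {}"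
  obtain F where "?P F" using ex_groupwise_dense_family_inter_empty by (elim exE)
  then obtain F0 where F0: "?P F0" "is_min_card ?P |F0|"
    by (rule is_min_card_exists[of ?P])
  \<comment> \<open>The lower bound for additivity: a failure pulls back to a family with empty
    intersection that is no larger.\<close>
  have "|F0| \<le>o |F|" if F: "\<forall>G\<in>F. groupwise_dense G" "\<not> groupwise_dense (family_inter F)" for F
  proof -
    obtain F' where "?P F'" "|F'| \<le>o |F|" using pullback_family_inter_empty[OF F] by blast
    moreover from this have "|F0| \<le>o |F'|" using F0(2) by (simp add: is_min_card_def)
    ultimately show ?thesis using ordLeq_transitive by blast
  qed
  \<comment> \<open>The upper bound: the empty family of sets is not groupwise dense, so
    \<open>F0\<close> itself witnesses the failure of additivity.\<close>
  moreover have "\<not> groupwise_dense (family_inter F0)"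
    using F0(1) groupwise_dense_nonempty by auto
  ultimately have "is_add nonmeager_filter |F0|"
    using F0(1) card_of_refl[of F0]
    unfolding is_add_def is_min_card_def sub nonmeager_filter_iff
    by (blast intro: card_of_Card_order)
  moreover have "is_cov nonmeager_filter |F0|" "is_groupwise_density_number |F0|"
    using F0(2) by (simp_all add: is_cov_def is_groupwise_density_number_def sub)
  ultimately show "\<exists>\<kappa> :: nat set set rel. is_add nonmeager_filter \<kappa> \<and>
      is_cov nonmeager_filter \<kappa> \<and> is_groupwise_density_number \<kappa>"
    by blast
next
  let ?Q = "\<lambda>Y. Y \<subseteq> infinite_sets \<and> (\<forall>A\<in>nonmeager_filter. Y \<inter> A \<noteq> {})"
  have lower: "|UNIV :: nat set set| \<le>o |Y|" if Y: "?Q Y" for Y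
  proof (rule ccontr)
    assume "\<not> ?thesis"
    then have "|Y| <o |UNIV :: nat set set|"
      by (simp add: card_of_Well_order not_ordLeq_iff_ordLess)
    then have "not_above Y \<in> nonmeager_filter"
      using groupwise_dense_not_above Y nonmeager_filter_iff by blast
    moreover have "Y \<inter> not_above Y = {}" by (auto simp: not_above_def)
    ultimately show False using Y by blast
  qed
  \<comment> \<open>The whole of \<open>infinite_sets\<close> attains the minimum; its size is
    pinned down by \<open>lower\<close> and by inclusion in \<open>UNIV\<close>.\<close>
  have Q: "?Q infinite_sets"
    using groupwise_dense_nonempty nonmeager_filter_iff
    by (fastforce simp: groupwise_dense_def downward_closed_def)
  have "|infinite_sets| =o |UNIV :: nat set set|"
    using lower[OF Q] card_of_mono1[OF subset_UNIV, of infinite_sets] by (simp add: ordIso_iff_ordLeq)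
  then have "|infinite_sets| =o ctwo ^c natLeq"
    using ctwo_cexp_natLeq ordIso_symmetric ordIso_transitive by blast
  moreover have "ctwo ^c natLeq \<le>o |Y|" if "?Q Y" for Y
    using lower[OF that] ctwo_cexp_natLeq ordIso_ordLeq_trans by blast
  moreover have "Card_order (ctwo ^c natLeq)" by (rule Card_order_cexp)
  ultimately show "is_unif nonmeager_filter (ctwo ^c natLeq)"
    using Q unfolding is_unif_def is_min_card_def by blast
qed

end
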